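(* Let $\sigma$ be a primitive Pisot substitution such that its substitution matrix $M_\sigma$ is diagonalizable over $\mathbb{C}$. Then every $\Lambda\in\mathbb{X}_\sigma$ is bounded distance equivalent to the lattice $\operatorname{dens}(\Lambda)^{-1}\,\mathbb{Z}$.
   Context: Let $\mathcal{A}=\{a_1,\dots,a_m\}$ be a finite alphabet and $\mathcal{A}^*$ the set of finite words over it. A symbolic substitution is a map $\sigma:\mathcal{A}^*\to\mathcal{A}^*$ with $\sigma(uv)=\sigma(u)\sigma(v)$ for all words $u,v$. Its substitution matrix is $M_\sigma=(|\sigma(a_j)|_i)_{1\le i,j\le m}$, where $|\sigma(a_j)|_i$ is the number of letters $a_i$ in $\sigma(a_j)$. $\sigma$ is primitive if some power $M_\sigma^k$ has only positive entries. A primitive substitution is a Pisot substitution if $M_\sigma$ has one simple positive real eigenvalue $\lambda>1$ and all other eigenvalues (real or complex) have absolute value less than $1$ (the eigenvalue $0$ is allowed). Symbolic hull: $X_\sigma$ is the set of all bi-infinite sequences $u\in\mathcal{A}^{\mathbb{Z}}$ such that each finite subword of $u$ is contained in some $\sigma^k(a_i)$. Natural tile lengths: $(\ell_1,\dots,\ell_m)$ is a left eigenvector of $M_\sigma$ with positive entries for the Perron-Frobenius eigenvalue $\lambda$ (unique up to overall scaling; one such choice is fixed). Geometric hull: $\mathbb{X}_\sigma$ is the set of all point sets $\Lambda=\{\dots,x_{-1},x_0=0,x_1,\dots\}\subset\mathbb{R}$ arising from some $u=(u_i)_{i\in\mathbb{Z}}\in X_\sigma$ as the left endpoints of the intervals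 in the tiling of the line obtained by replacing each letter $a_i$ by an interval of length $\ell_i$; that is, $x_0=0$ and $x_{j+1}-x_j=\ell_i$ whenever $u_j=a_i$. Density: $\operatorname{dens}(\Lambda)=\lim_{n\to\infty}\frac{1}{2n}|\Lambda\cap[-n,n]|$. For $\Lambda\in\mathbb{X}_\sigma$ it exists and equals $\left(\sum_{i=1}^m v_i\ell_i\right)^{-1}$, where $(v_1,\dots,v_m)^T$ is the right eigenvector of $M_\sigma$ for $\lambda$ normalized so that $\sum_i v_i=1$. Bounded distance equivalence: Two discrete point sets $\Lambda,\Lambda'\subset\mathbb{R}$ are bounded distance equivalent if there are $c>0$ and a bijection $\varphi:\Lambda\to\Lambda'$ with $|x-\varphi(x)|<c$ for all $x\in\Lambda$. *)

theory Defs
  imports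
    Complex_Main
    "HOL-Library.FuncSet"
    "HOL-Library.Sublist"
    "Jordan_Normal_Form.Spectral_Radius"
begin

(* The alphabet a_1, ..., a_m is identified with the index set {..<m}, so the indices of
   matrices and vectors are the letters themselves. *)

definition is_substitution :: "nat \<Rightarrow> (nat list \<Rightarrow> nat list) \<Rightarrow> bool" where
  "is_substitution m \<sigma> \<longleftrightarrow>
     \<sigma> \<in> lists {..<m} \<rightarrow> lists {..<m} \<and>
     (\<forall>u \<in> lists {..<m}. \<forall>v \<in> lists {..<m}. \<sigma> (u @ v) = \<sigma> u @ \<sigma> v)"

definition subst_mat :: "nat \<Rightarrow> (nat list \<Rightarrow> nat list) \<Rightarrow> nat mat" where
  "subst_mat m \<sigma> = mat m m (\<lambda>(i, j). count_list (\<sigma> [j]) i)"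

abbreviation subst_mat_real :: "nat \<Rightarrow> (nat list \<Rightarrow> nat list) \<Rightarrow> real mat" where
  "subst_mat_real m \<sigma> \<equiv> map_mat of_nat (subst_mat m \<sigma>)"

abbreviation subst_mat_complex :: "nat \<Rightarrow> (nat list \<Rightarrow> nat list) \<Rightarrow> complex mat" where
  "subst_mat_complex m \<sigma> \<equiv> map_mat of_nat (subst_mat m \<sigma>)"

definition primitive_subst :: "nat \<Rightarrow> (nat list \<Rightarrow> nat list) \<Rightarrow> bool" where
  "primitive_subst m \<sigma> \<longleftrightarrow>
     is_substitution m \<sigma> \<and>
     (\<exists>k>0. \<forall>i<m. \<forall>j<m. (subst_mat m \<sigma> ^\<^sub>m k) $$ (i, j) > 0)"

(* "Simple" means algebraic multiplicity one. *)
definition pisot_subst :: "nat \<Rightarrow> (nat list \<Rightarrow> nat list) \<Rightarrow> bool" where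
  "pisot_subst m \<sigma> \<longleftrightarrow>
     primitive_subst m \<sigma> \<and>
     (\<exists>r::real. r > 1 \<and>
        eigenvalue (subst_mat_complex m \<sigma>) (of_real r) \<and>
        Polynomial.order (of_real r) (char_poly (subst_mat_complex m \<sigma>)) = 1 \<and>
        (\<forall>\<mu>. eigenvalue (subst_mat_complex m \<sigma>) \<mu> \<and> \<mu> \<noteq> of_real r \<longrightarrow> cmod \<mu> < 1))"

definition diagonalizable_mat :: "'a :: semiring_1 mat \<Rightarrow> bool" where
  "diagonalizable_mat A \<longleftrightarrow> (\<exists>D. diagonal_mat D \<and> similar_mat A D)"

definition symbolic_hull :: "nat \<Rightarrow> (nat list \<Rightarrow> nat list) \<Rightarrow> (int \<Rightarrow> nat) set" where
  "symbolic_hull m \<sigma> =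
     {u. range u \<subseteq> {..<m} \<and>
         (\<forall>a b. \<exists>k. \<exists>i<m. sublist (map u [a..b]) ((\<sigma> ^^ k) [i]))}"

(* The Perron-Frobenius eigenvalue of a nonnegative matrix is its spectral radius; a left
   eigenvector is an eigenvector of the transpose. *)
definition natural_tile_lengths :: "nat \<Rightarrow> (nat list \<Rightarrow> nat list) \<Rightarrow> real vec \<Rightarrow> bool" where
  "natural_tile_lengths m \<sigma> l \<longleftrightarrow>
     eigenvector (transpose_mat (subst_mat_real m \<sigma>)) l
       (spectral_radius (subst_mat_complex m \<sigma>)) \<and>
     (\<forall>i<m. l $ i > 0)"

definition geometric_hull ::
    "nat \<Rightarrow> (nat list \<Rightarrow> nat list) \<Rightarrow> real vec \<Rightarrow> real set set" where
  "geometric_hull m \<sigma> l =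
     {\<Lambda>. \<exists>u \<in> symbolic_hull m \<sigma>. \<exists>x :: int \<Rightarrow> real.
          x 0 = 0 \<and> (\<forall>j. x (j + 1) - x j = l $ u j) \<and> \<Lambda> = range x}"

definition dens :: "real set \<Rightarrow> real" where
  "dens \<Lambda> = lim (\<lambda>n::nat. real (card (\<Lambda> \<inter> {- real n .. real n})) / (2 * real n))"

definition bounded_distance_equivalent :: "real set \<Rightarrow> real set \<Rightarrow> bool" where
  "bounded_distance_equivalent \<Lambda> \<Lambda>' \<longleftrightarrow>
     (\<exists>c>0. \<exists>\<phi>. bij_betw \<phi> \<Lambda> \<Lambda>' \<and> (\<forall>x\<in>\<Lambda>. \<bar>x - \<phi> x\<bar> < c))"

end

theory Submission
  imports Defs
begin

text \<open>
  Enumerate a set in the hull as \<open>x\<close> with \<open>x 0 = 0\<close>. If \<open>j - \<beta> * x j\<close> is bounded for some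
  \<open>\<beta> > 0\<close>, then \<open>\<beta>\<close> is the density and \<open>x j \<mapsto> j / \<beta>\<close> is the required bijection onto the lattice.
  Since \<open>j\<close> counts the letters of a factor \<open>w\<close> of the underlying sequence and \<open>x j\<close> adds up their
  tile lengths (up to a sign for negative \<open>j\<close>), it suffices to bound the weight of \<open>w\<close> that gives
  each letter \<open>b\<close> the value \<open>1 - \<beta> * l $ b\<close>, uniformly over all factors \<open>w\<close> of words
  \<open>\<sigma>\<^sup>k(a)\<close>.

  Two facts give this bound. A left eigenvector \<open>q\<close> of the substitution matrix with eigenvalue \<open>d\<close>
  is exactly a letter weight that \<open>\<sigma>\<close> multiplies by \<open>d\<close>. A prefix of \<open>\<sigma>\<^sup>k\<^sup>+\<^sup>1(a)\<close> is the image
  of a prefix of \<open>\<sigma>\<^sup>k(a)\<close> followed by a prefix of the image of a single letter, so if the modulus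
  of \<open>d\<close> is less than 1 the weights of prefixes obey a contracting affine recursion and stay
  bounded; a factor is a difference of two prefixes
  (\<open>contracting_weight_bounded_on_factors\<close>).

  Diagonalizability supplies a basis of left eigenvectors. By the Pisot condition the dominant
  eigenvalue is simple, so its eigenvectors are the multiples of the tile length vector \<open>l\<close>, while
  all others contract. Hence the constant weight 1 is \<open>\<alpha> * l\<close> plus a combination of contracting
  eigenvectors (\<open>functional_decomposition\<close>). The number \<open>\<alpha>\<close> comes out complex; taking real parts
  of the bounded quantity makes \<open>\<beta> = Re \<alpha>\<close> work, so the density appears as a coefficient in this expansion.
\<close>

section \<open>Letter weights that contract under the substitution\<close>

lemma substitution_Nil:
  assumes "is_substitution m \<sigma>"
  shows "\<sigma> [] = []"
proof -
  have "\<sigma> ([] @ []) = \<sigma> [] @ \<sigma> []"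
    using assms unfolding is_substitution_def by blast
  then show ?thesis by simp
qed

lemma substitution_append:
  assumes "is_substitution m \<sigma>" "u \<in> lists {..<m}" "v \<in> lists {..<m}"
  shows "\<sigma> (u @ v) = \<sigma> u @ \<sigma> v"
  using assms unfolding is_substitution_def by blast

lemma substitution_in_lists:
  assumes "is_substitution m \<sigma>" "u \<in> lists {..<m}"
  shows "\<sigma> u \<in> lists {..<m}"
  using assms unfolding is_substitution_def by blast

lemma substitution_power_in_lists:
  assumes "is_substitution m \<sigma>" "u \<in> lists {..<m}"
  shows "(\<sigma> ^^ k) u \<in> lists {..<m}"
  by (induction k) (use assms substitution_in_lists[OF assms(1)] in simp_all)

text \<open>
  Rewrites the weight of a word through its letter counts; applied to \<open>\<sigma> [b]\<close>, whose letter
  counts form a column of the substitution matrix, it turns the left eigenvector equation into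
  the hypothesis of the next lemma.
\<close>

lemma sum_list_eq_sum_count:
  fixes q :: "nat \<Rightarrow> complex"
  assumes "w \<in> lists {..<m}"
  shows "(\<Sum>x\<leftarrow>w. q x) = (\<Sum>a<m. q a * of_nat (count_list w a))"
  using assms
proof (induction w)
  case (Cons b w)
  then have b: "b \<in> {..<m}" by simp
  have "(\<Sum>a<m. q a * of_nat (count_list (b # w) a)) =
        (\<Sum>a<m. (if a = b then q b else 0) + q a * of_nat (count_list w a))"
    by (intro sum.cong) (auto simp: algebra_simps)
  also have "\<dots> = q b + (\<Sum>a<m. q a * of_nat (count_list w a))"
    using b by (simp add: sum.distrib)
  finally show ?case using Cons by simp
qed simp

lemma weight_substitution:
  fixes q :: "nat \<Rightarrow> complex"
  assumes S: "is_substitution m \<sigma>"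
    and ev: "\<And>b. b < m \<Longrightarrow> (\<Sum>x\<leftarrow>\<sigma> [b]. q x) = d * q b"
    and w: "w \<in> lists {..<m}"
  shows "(\<Sum>x\<leftarrow>\<sigma> w. q x) = d * (\<Sum>x\<leftarrow>w. q x)"
  using w
proof (induction w)
  case Nil
  then show ?case by (simp add: substitution_Nil[OF S])
next
  case (Cons b w)
  then have "\<sigma> (b # w) = \<sigma> [b] @ \<sigma> w"
    using substitution_append[OF S, of "[b]" w] by auto
  then show ?case using Cons ev[of b] by (auto simp: algebra_simps)
qed

text \<open>
  Cut \<open>w\<close> at the last boundary between images of letters that it reaches; what remains lies inside
  the image of one letter. For empty \<open>v\<close> there may be no letter at all, which is why that case is
  excluded.
\<close>

lemma prefix_substitution_cases:
  assumes S: "is_substitution m \<sigma>"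
    and v: "v \<in> lists {..<m}" and p: "prefix w (\<sigma> v)" and ne: "v \<noteq> []"
  obtains v' b q where "prefix v' v" "b < m" "prefix q (\<sigma> [b])" "w = \<sigma> v' @ q"
proof -
  have "\<exists>v' b q. prefix v' v \<and> b < m \<and> prefix q (\<sigma> [b]) \<and> w = \<sigma> v' @ q"
    using v p ne
  proof (induction v rule: rev_induct)
    case (snoc c v)
    have c: "c < m" and v: "v \<in> lists {..<m}" using snoc.prems by auto
    have "\<sigma> (v @ [c]) = \<sigma> v @ \<sigma> [c]"
      using substitution_append[OF S v] c by auto
    then consider "prefix w (\<sigma> v)" | us where "w = \<sigma> v @ us" "prefix us (\<sigma> [c])"
      using snoc.prems by (auto simp: prefix_append)
    then show ?case
    proof cases
      case 1
      show ?thesis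
      proof (cases "v = []")
        case True
        then have "prefix [] (v @ [c])" "prefix [] (\<sigma> [c])" "w = \<sigma> [] @ []"
          using 1 substitution_Nil[OF S] by simp_all
        then show ?thesis using c by blast
      next
        case False
        then show ?thesis using snoc.IH[OF v 1] prefix_order.trans[of _ v "v @ [c]"] by auto
      qed
    next
      case 2
      then show ?thesis using c by (metis prefixI)
    qed
  qed simp
  then show thesis using that by blast
qed

lemma norm_weight_prefix_le:
  fixes q :: "nat \<Rightarrow> complex"
  assumes "prefix p w"
  shows "norm (\<Sum>x\<leftarrow>p. q x) \<le> (\<Sum>x\<leftarrow>w. norm (q x))"
proof -
  obtain s where w: "w = p @ s" using assms by (auto simp: prefix_def)
  have "norm (\<Sum>x\<leftarrow>p. q x) \<le> (\<Sum>x\<leftarrow>p. norm (q x))"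
    by (induction p) (auto intro: norm_triangle_le)
  moreover have "0 \<le> (\<Sum>x\<leftarrow>s. norm (q x))" by (intro sum_list_nonneg) auto
  ultimately show ?thesis by (simp add: w)
qed

text \<open>
  Induction on \<open>k\<close> by \<open>prefix_substitution_cases\<close>: passing from \<open>k\<close> to \<open>k + 1\<close> multiplies the weight
  by \<open>d\<close> and adds the weight of a prefix of some \<open>\<sigma> [b]\<close>, which is at most a constant \<open>K\<close>. Thus any
  bound that dominates the base case and the fixed point of \<open>t \<mapsto> norm d * t + K\<close> persists.
\<close>

lemma contracting_weight_bounded_on_prefixes:
  fixes q :: "nat \<Rightarrow> complex"
  assumes S: "is_substitution m \<sigma>"
    and ev: "\<And>b. b < m \<Longrightarrow> (\<Sum>x\<leftarrow>\<sigma> [b]. q x) = d * q b"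
    and d: "norm d < 1"
  obtains C where "\<And>k i p. i < m \<Longrightarrow> prefix p ((\<sigma> ^^ k) [i]) \<Longrightarrow> norm (\<Sum>x\<leftarrow>p. q x) \<le> C"
proof -
  (* one constant for both parts of the induction: the first sum controls the remainder in the
     image of one letter, the second one the single letters of the base case *)
  define K where "K = (\<Sum>b<m. \<Sum>x\<leftarrow>\<sigma> [b]. norm (q x)) + (\<Sum>b<m. norm (q b))"
  (* the fixed point of the recursion C = norm d * C + K *)
  define C where "C = K / (1 - norm d)"
  have nn: "0 \<le> (\<Sum>x\<leftarrow>\<sigma> [b]. norm (q x))" for b by (intro sum_list_nonneg) auto
  have K0: "0 \<le> K" unfolding K_def by (intro add_nonneg_nonneg sum_nonneg nn) auto
  have Keq: "norm d * C + K = C" using d by (simp add: C_def field_simps)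
  have "0 \<le> norm d * C" unfolding C_def using K0 d by simp
  then have KC: "K \<le> C" using Keq by linarith
  have K1: "norm (q b) \<le> K" if "b < m" for b
  proof -
    have "norm (q b) \<le> (\<Sum>b<m. norm (q b))"
      using that by (intro member_le_sum) auto
    moreover have "0 \<le> (\<Sum>b<m. \<Sum>x\<leftarrow>\<sigma> [b]. norm (q x))" by (intro sum_nonneg nn)
    ultimately show ?thesis by (simp add: K_def)
  qed
  have K2: "(\<Sum>x\<leftarrow>\<sigma> [b]. norm (q x)) \<le> K" if "b < m" for b
  proof -
    have "(\<Sum>x\<leftarrow>\<sigma> [b]. norm (q x)) \<le> (\<Sum>b<m. \<Sum>x\<leftarrow>\<sigma> [b]. norm (q x))"
      using that nn by (intro member_le_sum) auto
    moreover have "0 \<le> (\<Sum>b<m. norm (q b))" by (intro sum_nonneg) auto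
    ultimately show ?thesis by (simp add: K_def)
  qed
  have "norm (\<Sum>x\<leftarrow>p. q x) \<le> C" if "i < m" "prefix p ((\<sigma> ^^ k) [i])" for k i p
    using that(2)
  proof (induction k arbitrary: p)
    case 0
    then have "norm (\<Sum>x\<leftarrow>p. q x) \<le> norm (q i)"
      using norm_weight_prefix_le[of p "[i]" q] by simp
    then show ?case using K1[OF that(1)] KC by linarith
  next
    case (Suc k)
    let ?v = "(\<sigma> ^^ k) [i]"
    have v: "?v \<in> lists {..<m}"
      using substitution_power_in_lists[OF S, of "[i]" k] that(1) by simp
    have p: "prefix p (\<sigma> ?v)" using Suc.prems by simp
    show ?case
    proof (cases "?v = []")
      case True
      then have "p = []" using p substitution_Nil[OF S] by simp
      then show ?thesis using K0 KC by simp
    next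
      case False
      obtain v' b r where *: "prefix v' ?v" "b < m" "prefix r (\<sigma> [b])" "p = \<sigma> v' @ r"
        using prefix_substitution_cases[OF S v p False] .
      have v': "v' \<in> lists {..<m}"
        using v *(1) by (auto simp: prefix_def)
      have "(\<Sum>x\<leftarrow>p. q x) = d * (\<Sum>x\<leftarrow>v'. q x) + (\<Sum>x\<leftarrow>r. q x)"
        using weight_substitution[OF S ev v'] *(4) by simp
      then have "norm (\<Sum>x\<leftarrow>p. q x) \<le> norm d * norm (\<Sum>x\<leftarrow>v'. q x) + norm (\<Sum>x\<leftarrow>r. q x)"
        by (metis norm_triangle_ineq norm_mult)
      also have "\<dots> \<le> norm d * C + K"
        using Suc.IH[OF *(1)] norm_weight_prefix_le[OF *(3), of q] K2[OF *(2)]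
        by (intro add_mono mult_left_mono) auto
      finally show ?thesis using Keq by simp
    qed
  qed
  then show thesis using that by blast
qed

lemma contracting_weight_bounded_on_factors:
  fixes q :: "nat \<Rightarrow> complex"
  assumes S: "is_substitution m \<sigma>"
    and ev: "\<And>b. b < m \<Longrightarrow> (\<Sum>x\<leftarrow>\<sigma> [b]. q x) = d * q b"
    and d: "norm d < 1"
  obtains C where "\<And>k i w. i < m \<Longrightarrow> sublist w ((\<sigma> ^^ k) [i]) \<Longrightarrow> norm (\<Sum>x\<leftarrow>w. q x) \<le> C"
proof -
  obtain C where C: "\<And>k i p. i < m \<Longrightarrow> prefix p ((\<sigma> ^^ k) [i]) \<Longrightarrow> norm (\<Sum>x\<leftarrow>p. q x) \<le> C"
    using contracting_weight_bounded_on_prefixes[OF S ev d] by blast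
  have "norm (\<Sum>x\<leftarrow>w. q x) \<le> 2 * C" if i: "i < m" and w: "sublist w ((\<sigma> ^^ k) [i])" for k i w
  proof -
    obtain p s where e: "(\<sigma> ^^ k) [i] = p @ w @ s" using w by (auto simp: sublist_def)
    have "norm (\<Sum>x\<leftarrow>p @ w. q x) \<le> C" "norm (\<Sum>x\<leftarrow>p. q x) \<le> C"
      by (rule C[OF i, of _ k]; simp add: e)+
    then have "norm ((\<Sum>x\<leftarrow>p @ w. q x) - (\<Sum>x\<leftarrow>p. q x)) \<le> 2 * C"
      using norm_triangle_ineq4[of "\<Sum>x\<leftarrow>p @ w. q x" "\<Sum>x\<leftarrow>p. q x"] by linarith
    then show ?thesis by simp
  qed
  then show thesis using that by blast
qed

section \<open>Expanding a functional in left eigenvectors\<close>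

text \<open>
  If \<open>A = P D Q\<close> with \<open>P\<close> and \<open>Q\<close> inverse to each other, then \<open>Q A = D Q\<close> makes the rows of \<open>Q\<close> left
  eigenvectors and \<open>A P = P D\<close> makes the columns of \<open>P\<close> right eigenvectors. Everything is stated
  with entries and finite sums because the rows are later used as plain letter weights.
\<close>

lemma diagonalizable_left_eigenbasis:
  fixes A :: "complex mat"
  assumes A: "A \<in> carrier_mat n n" and diag: "diagonalizable_mat A"
  obtains P Q d where
    "\<And>k b. k < n \<Longrightarrow> b < n \<Longrightarrow> (\<Sum>a<n. Q k a * A $$ (a, b)) = d k * Q k b"
    "\<And>k a. k < n \<Longrightarrow> a < n \<Longrightarrow> (\<Sum>b<n. A $$ (a, b) * P b k) = d k * P a k"
    "\<And>a b. a < n \<Longrightarrow> b < n \<Longrightarrow> (\<Sum>k<n. P a k * Q k b) = (if a = b then 1 else 0)"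
    "char_poly A = (\<Prod>k<n. [:- d k, 1:])"
proof -
  obtain D P Q where D: "diagonal_mat D" and wit: "similar_mat_wit A D P Q"
    using diag unfolding diagonalizable_mat_def similar_mat_def by blast
  note w = similar_mat_witD2[OF A wit]
  have cD: "D \<in> carrier_mat n n" and cP: "P \<in> carrier_mat n n" and cQ: "Q \<in> carrier_mat n n"
    using w by auto
  have D0: "D $$ (i, j) = 0" if "i < n" "j < n" "i \<noteq> j" for i j
    using D that cD unfolding diagonal_mat_def by auto
  have AP: "A * P = P * D"
  proof -
    have "A * P = P * D * (Q * P)" using w(3) cD cP cQ by (simp add: assoc_mult_mat[of _ n n _ n _ n])
    then show ?thesis using w(2) cD cP by simp
  qed
  have QA: "Q * A = D * Q"
  proof -
    have "Q * A = (Q * P) * D * Q" using w(3) cD cP cQ by (simp add: assoc_mult_mat[of _ n n _ n _ n])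
    then show ?thesis using w(2) cD cQ by simp
  qed
  have prod: "(X * Y) $$ (i, j) = (\<Sum>k<n. X $$ (i, k) * Y $$ (k, j))"
    if "X \<in> carrier_mat n n" "Y \<in> carrier_mat n n" "i < n" "j < n" for X Y :: "complex mat" and i j
    using that by (auto simp: scalar_prod_def atLeast0LessThan intro!: sum.cong)
  show thesis
  proof (rule that[of "\<lambda>k a. Q $$ (k, a)" "\<lambda>k. D $$ (k, k)" "\<lambda>a k. P $$ (a, k)"])
    fix k b assume kb: "k < n" "b < n"
    have "(\<Sum>a<n. Q $$ (k, a) * A $$ (a, b)) = (\<Sum>a<n. D $$ (k, a) * Q $$ (a, b))"
      using prod[OF cQ A kb] prod[OF cD cQ kb] QA by simp
    also have "\<dots> = (\<Sum>a<n. if a = k then D $$ (k, k) * Q $$ (k, b) else 0)"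
      using kb D0 by (intro sum.cong) auto
    finally show "(\<Sum>a<n. Q $$ (k, a) * A $$ (a, b)) = D $$ (k, k) * Q $$ (k, b)"
      using kb by simp
  next
    fix k a assume ka: "k < n" "a < n"
    have "(\<Sum>b<n. A $$ (a, b) * P $$ (b, k)) = (\<Sum>b<n. P $$ (a, b) * D $$ (b, k))"
      using prod[OF A cP ka(2,1)] prod[OF cP cD ka(2,1)] AP by simp
    also have "\<dots> = (\<Sum>b<n. if b = k then D $$ (k, k) * P $$ (a, k) else 0)"
      using ka D0 by (intro sum.cong) auto
    finally show "(\<Sum>b<n. A $$ (a, b) * P $$ (b, k)) = D $$ (k, k) * P $$ (a, k)"
      using ka by simp
  next
    fix a b assume ab: "a < n" "b < n"
    show "(\<Sum>k<n. P $$ (a, k) * Q $$ (k, b)) = (if a = b then 1 else 0)"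
      using prod[OF cP cQ ab] w(1) ab by simp
  next
    have "upper_triangular D" using cD D0 by (auto simp: upper_triangular_def)
    then have "char_poly D = (\<Prod>a\<leftarrow>diag_mat D. [:- a, 1:])"
      using char_poly_upper_triangular[OF cD] by simp
    also have "\<dots> = (\<Prod>k<n. [:- D $$ (k, k), 1:])"
      using cD by (simp add: diag_mat_def comp_def prod.list_conv_set_nth interv_sum_list_conv_sum_set_nat atLeast0LessThan)
    finally show "char_poly A = (\<Prod>k<n. [:- D $$ (k, k), 1:])"
      using char_poly_similar[of A D] diag wit unfolding similar_mat_def by auto
  qed
qed

lemma simple_root_of_prod_linear:
  fixes d :: "nat \<Rightarrow> complex"
  assumes ord: "Polynomial.order r (\<Prod>k<n. [:- d k, 1:]) = 1"
    and "i < n" "j < n" "d i = r" "d j = r"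
  shows "i = j"
proof (rule ccontr)
  assume ne: "i \<noteq> j"
  have "(\<Prod>k\<in>{i, j}. [:- d k, 1:]) dvd (\<Prod>k<n. [:- d k, 1:])"
    using assms by (intro prod_dvd_prod_subset) auto
  moreover have "(\<Prod>k\<in>{i, j}. [:- d k, 1:]) = [:- r, 1:] ^ 2"
    using assms ne by (simp add: power2_eq_square del: mult_pCons_left mult_pCons_right)
  ultimately have "[:- r, 1:] ^ 2 dvd (\<Prod>k<n. [:- d k, 1:])" by simp
  moreover have "(\<Prod>k<n. [:- d k, 1:]) \<noteq> 0" by simp
  ultimately have "2 \<le> Polynomial.order r (\<Prod>k<n. [:- d k, 1:])"
    by (metis order_divides)
  then show False using ord by simp
qed

text \<open>
  Expand both \<open>f\<close> and \<open>l\<close> in the rows of \<open>Q\<close>, the coefficient along row \<open>k\<close> being the pairing with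
  column \<open>k\<close> of \<open>P\<close>. The eigenvalue equation kills every coefficient of \<open>l\<close> whose eigenvalue is not
  \<open>\<rho>\<close>; as \<open>norm \<rho> \<ge> 1\<close> forces \<open>\<rho> = r\<close> and \<open>r\<close> is simple, \<open>l\<close> is a nonzero multiple of a single row
  \<open>k0\<close>. So the row \<open>k0\<close> in the expansion of \<open>f\<close> can be replaced by a multiple of \<open>l\<close>, and all other
  rows have eigenvalues inside the unit disc.
\<close>

lemma functional_decomposition:
  fixes A :: "complex mat" and f l :: "nat \<Rightarrow> complex"
  assumes A: "A \<in> carrier_mat n n" and diag: "diagonalizable_mat A"
    and ord: "Polynomial.order r (char_poly A) = 1"
    and others: "\<And>\<mu>. eigenvalue A \<mu> \<Longrightarrow> \<mu> \<noteq> r \<Longrightarrow> norm \<mu> < 1"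
    and l: "\<And>b. b < n \<Longrightarrow> (\<Sum>a<n. l a * A $$ (a, b)) = \<rho> * l b"
    and rho: "norm \<rho> \<ge> 1"
    and l0: "b0 < n" "l b0 \<noteq> 0"
  obtains \<alpha> K t q d where "finite (K :: nat set)"
    "\<And>b. b < n \<Longrightarrow> f b = \<alpha> * l b + (\<Sum>k\<in>K. t k * q k b)"
    "\<And>k. k \<in> K \<Longrightarrow> norm (d k) < 1"
    "\<And>k b. k \<in> K \<Longrightarrow> b < n \<Longrightarrow> (\<Sum>a<n. q k a * A $$ (a, b)) = d k * q k b"
proof -
  obtain P Q d where
    Q: "\<And>k b. k < n \<Longrightarrow> b < n \<Longrightarrow> (\<Sum>a<n. Q k a * A $$ (a, b)) = d k * Q k b" and
    P: "\<And>k a. k < n \<Longrightarrow> a < n \<Longrightarrow> (\<Sum>b<n. A $$ (a, b) * P b k) = d k * P a k" and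
    PQ: "\<And>a b. a < n \<Longrightarrow> b < n \<Longrightarrow> (\<Sum>k<n. P a k * Q k b) = (if a = b then 1 else 0)" and
    cp: "char_poly A = (\<Prod>k<n. [:- d k, 1:])"
    by (rule diagonalizable_left_eigenbasis[OF A diag]) (rule that)
  define coef where "coef g k = (\<Sum>a<n. g a * P a k)" for g :: "nat \<Rightarrow> complex" and k
  have expand: "g b = (\<Sum>k<n. coef g k * Q k b)" if "b < n" for g b
  proof -
    have "(\<Sum>k<n. coef g k * Q k b) = (\<Sum>a<n. g a * (\<Sum>k<n. P a k * Q k b))"
      unfolding coef_def sum_distrib_left sum_distrib_right mult.assoc by (rule sum.swap)
    also have "\<dots> = (\<Sum>a<n. if a = b then g a else 0)"
      using PQ that by (intro sum.cong) auto
    finally show ?thesis using that by simp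
  qed
  have ev: "eigenvalue A (d k)" if "k < n" for k
    using that by (auto simp: eigenvalue_root_char_poly[OF A] cp poly_prod)
  have coef_l: "\<rho> * coef l k = d k * coef l k" if "k < n" for k
  proof -
    have "\<rho> * coef l k = (\<Sum>b<n. (\<Sum>a<n. l a * A $$ (a, b)) * P b k)"
      using l by (simp add: coef_def sum_distrib_left mult.assoc)
    also have "\<dots> = (\<Sum>a<n. l a * (\<Sum>b<n. A $$ (a, b) * P b k))"
      unfolding sum_distrib_left sum_distrib_right mult.assoc by (rule sum.swap)
    also have "\<dots> = d k * coef l k"
      using P that by (simp add: coef_def sum_distrib_left mult.left_commute)
    finally show ?thesis .
  qed
  have dk: "d k = \<rho>" if "k < n" "coef l k \<noteq> 0" for k using coef_l[OF that(1)] that(2) by simp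
  have "\<exists>k<n. coef l k \<noteq> 0"
  proof (rule ccontr)
    assume "\<not> ?thesis"
    then have "l b0 = 0" using expand[OF l0(1), of l] by simp
    then show False using l0 by simp
  qed
  then obtain k0 where k0: "k0 < n" "coef l k0 \<noteq> 0" by blast
  have "\<rho> = r"
    using others[OF ev[OF k0(1)]] unfolding dk[OF k0] using rho by linarith
  then have uniq: "k = k0" if "k < n" "d k = r" for k
    using that simple_root_of_prod_linear[OF ord[unfolded cp] _ k0(1)] dk[OF k0] by metis
  have lQ: "l b = coef l k0 * Q k0 b" if "b < n" for b
  proof -
    have "coef l k * Q k b = (if k = k0 then coef l k0 * Q k0 b else 0)" if "k < n" for k
      using uniq[OF that] dk[OF that] \<open>\<rho> = r\<close> by (cases "k = k0") auto
    then have "(\<Sum>k<n. coef l k * Q k b) = (\<Sum>k<n. if k = k0 then coef l k0 * Q k0 b else 0)"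
      by (intro sum.cong) simp_all
    then show ?thesis using k0 expand[OF that, of l] by simp
  qed
  show thesis
  proof (rule that[of "{..<n} - {k0}" "coef f k0 / coef l k0" "coef f" Q d])
    fix b assume b: "b < n"
    have "f b = coef f k0 * Q k0 b + (\<Sum>k\<in>{..<n} - {k0}. coef f k * Q k b)"
      using expand[OF b, of f] k0 by (simp add: sum.remove[of "{..<n}" k0])
    then show "f b = coef f k0 / coef l k0 * l b + (\<Sum>k\<in>{..<n} - {k0}. coef f k * Q k b)"
      using lQ[OF b] k0 by simp
  next
    fix k assume "k \<in> {..<n} - {k0}"
    then have "k < n" "k \<noteq> k0" by simp_all
    then show "norm (d k) < 1" using others[OF ev] uniq by blast
  qed (use Q in auto)
qed

section \<open>Tilings with bounded discrepancy\<close>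

text \<open>
  The decomposition of the constant weight 1, summed over the letters of \<open>w\<close>, expresses
  \<open>length w - \<alpha> * l(w)\<close> as a fixed combination of contracting weights of \<open>w\<close>, each of which is
  bounded on factors.
\<close>

lemma length_minus_scaled_weight_bounded:
  assumes S: "is_substitution m \<sigma>" and pis: "pisot_subst m \<sigma>"
    and diag: "diagonalizable_mat (subst_mat_complex m \<sigma>)"
    and l: "natural_tile_lengths m \<sigma> l"
  obtains \<beta> B :: real where
    "\<And>k i w. i < m \<Longrightarrow> sublist w ((\<sigma> ^^ k) [i]) \<Longrightarrow>
       \<bar>real (length w) - \<beta> * (\<Sum>x\<leftarrow>w. l $ x)\<bar> \<le> B"
proof (cases "m = 0")
  case True
  then show thesis using that[of 0 0] by simp
next
  case False
  let ?A = "subst_mat_complex m \<sigma>"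
  have A: "?A \<in> carrier_mat m m" by (simp add: subst_mat_def)
  have Aent: "?A $$ (a, b) = of_nat (count_list (\<sigma> [b]) a)" if "a < m" "b < m" for a b
    using that by (simp add: subst_mat_def)
  obtain r :: real where r: "r > 1" "eigenvalue ?A (of_real r)"
    "Polynomial.order (of_real r) (char_poly ?A) = 1"
    "\<And>\<mu>. eigenvalue ?A \<mu> \<Longrightarrow> \<mu> \<noteq> of_real r \<Longrightarrow> norm \<mu> < 1"
    using pis unfolding pisot_subst_def by blast
  let ?\<rho> = "spectral_radius ?A"
  (* the eigenvalue of l is only known to be the spectral radius; that it is at least r > 1 is
     enough to keep l out of the contracting part *)
  have "cmod (of_real r) \<le> ?\<rho>"
  proof (rule spectral_radius_mem_max(2)[OF A])
    show "cmod (of_real r) \<in> cmod ` spectrum ?A"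
      using r(2) by (intro imageI) (simp add: spectrum_def)
  qed (use False in simp)
  then have rho: "norm (complex_of_real ?\<rho>) \<ge> 1" using r(1) by simp
  have ev: "eigenvector (transpose_mat (subst_mat_real m \<sigma>)) l ?\<rho>"
    and pos: "\<And>i. i < m \<Longrightarrow> l $ i > 0" using l unfolding natural_tile_lengths_def by auto
  have left: "(\<Sum>a<m. complex_of_real (l $ a) * ?A $$ (a, b)) = of_real ?\<rho> * of_real (l $ b)"
    if b: "b < m" for b
  proof -
    have dl: "dim_vec l = m" using ev by (simp add: eigenvector_def subst_mat_def)
    have "(transpose_mat (subst_mat_real m \<sigma>) *\<^sub>v l) $ b = (?\<rho> \<cdot>\<^sub>v l) $ b"
      using ev by (simp add: eigenvector_def)
    then have "(\<Sum>a<m. l $ a * real (count_list (\<sigma> [b]) a)) = ?\<rho> * l $ b"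
      using b dl by (simp add: subst_mat_def scalar_prod_def atLeast0LessThan mult.commute)
    then have "complex_of_real (\<Sum>a<m. l $ a * real (count_list (\<sigma> [b]) a)) = of_real (?\<rho> * l $ b)"
      by simp
    then show ?thesis using Aent b by simp
  qed
  have l0: "0 < m" "complex_of_real (l $ 0) \<noteq> 0"
    using False pos[of 0] by simp_all
  obtain \<alpha> K t q d where K: "finite (K :: nat set)"
    and dec: "\<And>b. b < m \<Longrightarrow> 1 = \<alpha> * complex_of_real (l $ b) + (\<Sum>k\<in>K. t k * q k b)"
    and d: "\<And>k. k \<in> K \<Longrightarrow> norm (d k) < 1"
    and q: "\<And>k b. k \<in> K \<Longrightarrow> b < m \<Longrightarrow> (\<Sum>a<m. q k a * ?A $$ (a, b)) = d k * q k b"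
    by (rule functional_decomposition[where f = "\<lambda>_. 1", OF A diag r(3,4) left rho l0])
      (assumption | rule that)+
  have "\<exists>C. \<forall>j i w. i < m \<longrightarrow> sublist w ((\<sigma> ^^ j) [i]) \<longrightarrow> norm (\<Sum>x\<leftarrow>w. q k x) \<le> C"
    if k: "k \<in> K" for k
  proof -
    have "(\<Sum>x\<leftarrow>\<sigma> [b]. q k x) = d k * q k b" if b: "b < m" for b
    proof -
      have "\<sigma> [b] \<in> lists {..<m}" using substitution_in_lists[OF S] b by simp
      then show ?thesis
        using sum_list_eq_sum_count[of "\<sigma> [b]" m "q k"] q[OF k b] Aent b by simp
    qed
    then show ?thesis using contracting_weight_bounded_on_factors[OF S _ d[OF k]] by metis
  qed
  then obtain C where C: "\<And>k j i w. k \<in> K \<Longrightarrow> i < m \<Longrightarrow> sublist w ((\<sigma> ^^ j) [i]) \<Longrightarrow>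
      norm (\<Sum>x\<leftarrow>w. q k x) \<le> C k" by metis
  show thesis
  proof (rule that[of "Re \<alpha>" "\<Sum>k\<in>K. norm (t k) * C k"])
    fix j i w assume i: "i < m" and w: "sublist w ((\<sigma> ^^ j) [i])"
    have wl: "w \<in> lists {..<m}"
      using substitution_power_in_lists[OF S, of "[i]" j] i w set_mono_sublist[OF w] by auto
    have eq: "of_nat (length w) =
        \<alpha> * complex_of_real (\<Sum>x\<leftarrow>w. l $ x) + (\<Sum>k\<in>K. t k * (\<Sum>x\<leftarrow>w. q k x))"
      using wl
    proof (induction w)
      case (Cons b w)
      then show ?case using dec[of b] by (simp add: algebra_simps sum.distrib)
    qed simp
    have "real (length w) - Re \<alpha> * (\<Sum>x\<leftarrow>w. l $ x) = Re (\<Sum>k\<in>K. t k * (\<Sum>x\<leftarrow>w. q k x))"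
      using arg_cong[OF eq, of Re] by simp
    also have "\<bar>\<dots>\<bar> \<le> norm (\<Sum>k\<in>K. t k * (\<Sum>x\<leftarrow>w. q k x))" by (rule abs_Re_le_cmod)
    also have "\<dots> \<le> (\<Sum>k\<in>K. norm (t k * (\<Sum>x\<leftarrow>w. q k x)))" by (rule norm_sum)
    also have "\<dots> \<le> (\<Sum>k\<in>K. norm (t k) * C k)"
      unfolding norm_mult using C[OF _ i w] by (intro sum_mono mult_left_mono) auto
    finally show "\<bar>real (length w) - Re \<alpha> * (\<Sum>x\<leftarrow>w. l $ x)\<bar> \<le> (\<Sum>k\<in>K. norm (t k) * C k)" .
  qed
qed

lemma sum_list_increments:
  fixes x :: "int \<Rightarrow> real"
  assumes "\<And>j. x (j + 1) - x j = g (u j)"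
  shows "(\<Sum>y\<leftarrow>map u [a..a + int n - 1]. g y) = x (a + int n) - x a"
proof (induction n)
  case (Suc n)
  have "[a..a + int (Suc n) - 1] = [a..a + int n - 1] @ [a + int n]"
    using upto_rec2[of a "a + int n"] by simp
  then show ?case using Suc assms[of "a + int n"] by (simp add: algebra_simps)
qed simp

text \<open>
  The indices \<open>j\<close> with \<open>\<bar>x j\<bar> \<le> n\<close> include all integers in \<open>[-(\<beta> * n - B), \<beta> * n - B]\<close> and lie in
  \<open>[-(\<beta> * n + B), \<beta> * n + B]\<close>, so their number differs from \<open>2 * \<beta> * n\<close> by a bounded amount.
\<close>

lemma dens_of_bounded_discrepancy:
  fixes x :: "int \<Rightarrow> real"
  assumes inj: "inj x" and beta: "\<beta> > 0" and B: "\<And>j. \<bar>real_of_int j - \<beta> * x j\<bar> \<le> B"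
  shows "dens (range x) = \<beta>"
proof -
  let ?N = "\<lambda>n::nat. real (card (range x \<inter> {- real n .. real n}))"
  have bound: "\<bar>?N n - 2 * \<beta> * real n\<bar> \<le> 2 * B + 1" for n
  proof -
    define J where "J = {j. \<bar>x j\<bar> \<le> real n}"
    define y where "y = \<beta> * real n"
    define hi where "hi = \<lfloor>y + B\<rfloor>"
    define lo where "lo = \<lfloor>y - B\<rfloor>"
    have "range x \<inter> {- real n .. real n} = x ` J" by (auto simp: J_def abs_le_iff)
    then have card_J: "card (range x \<inter> {- real n .. real n}) = card J"
      by (simp add: card_image inj_on_subset[OF inj])
    have B0: "0 \<le> B" using B[of 0] by linarith
    have upper: "J \<subseteq> {- hi..hi}"
    proof
      fix j assume "j \<in> J"
      then have "\<bar>\<beta> * x j\<bar> \<le> y" unfolding y_def using beta by (simp add: J_def abs_mult)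
      then have "\<bar>real_of_int j\<bar> \<le> y + B" using B[of j] by linarith
      then have "real_of_int \<bar>j\<bar> \<le> y + B" by simp
      then have "\<bar>j\<bar> \<le> hi" unfolding hi_def by (simp add: le_floor_iff)
      then show "j \<in> {- hi..hi}" by auto
    qed
    have lower: "{- lo..lo} \<subseteq> J"
    proof
      fix j assume "j \<in> {- lo..lo}"
      then have "\<bar>j\<bar> \<le> lo" by auto
      then have "real_of_int \<bar>j\<bar> \<le> y - B" unfolding lo_def by (simp add: le_floor_iff)
      then have "\<bar>\<beta> * x j\<bar> \<le> y" using B[of j] by (simp; linarith)
      then show "j \<in> J" unfolding y_def using beta by (simp add: J_def abs_mult)
    qed
    have fin: "finite J" using upper finite_subset by blast
    have "card J \<le> nat (2 * hi + 1)" using card_mono[OF _ upper] by simp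
    moreover have "0 \<le> hi" unfolding hi_def y_def using beta B0 by simp
    ultimately have "real (card J) \<le> 2 * real_of_int hi + 1" by linarith
    also have "\<dots> \<le> 2 * (y + B) + 1"
      using mult_left_mono[OF of_int_floor_le[of "y + B"], of 2] unfolding hi_def by simp
    finally have u: "real (card J) \<le> 2 * (y + B) + 1" .
    have "nat (2 * lo + 1) \<le> card J" using card_mono[OF fin lower] by simp
    then have "2 * real_of_int lo + 1 \<le> real (card J)" by linarith
    moreover have "y - B < real_of_int lo + 1" unfolding lo_def by linarith
    ultimately have v: "2 * (y - B) - 1 \<le> real (card J)" by simp
    then show ?thesis using u v card_J unfolding abs_le_iff by (simp add: y_def algebra_simps)
  qed
  have "(\<lambda>n. ?N n / (2 * real n) - \<beta>) \<longlonglongrightarrow> 0"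
  proof (rule tendsto_0_le[OF lim_inverse_n])
    show "\<forall>\<^sub>F n in sequentially. norm (?N n / (2 * real n) - \<beta>) \<le> norm (inverse (real n)) * (B + 1 / 2)"
      using eventually_gt_at_top[of 0]
    proof eventually_elim
      case (elim n)
      have "?N n / (2 * real n) - \<beta> = (?N n - 2 * \<beta> * real n) / (2 * real n)"
        using elim by (simp add: field_simps)
      then have "norm (?N n / (2 * real n) - \<beta>) = \<bar>?N n - 2 * \<beta> * real n\<bar> / (2 * real n)"
        by simp
      also have "\<dots> \<le> (2 * B + 1) / (2 * real n)"
        using bound[of n] by (intro divide_right_mono) auto
      also have "\<dots> = norm (inverse (real n)) * (B + 1 / 2)" using elim by (simp add: field_simps)
      finally show ?case .
    qed
  qed
  then have "(\<lambda>n. ?N n / (2 * real n)) \<longlonglongrightarrow> \<beta>" by (simp add: LIM_zero_iff)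
  then show ?thesis unfolding dens_def by (rule limI)
qed

lemma bounded_distance_equivalent_lattice:
  fixes x :: "int \<Rightarrow> real"
  assumes inj: "inj x" and beta: "\<beta> > 0" and B: "\<And>j. \<bar>real_of_int j - \<beta> * x j\<bar> \<le> B"
  shows "bounded_distance_equivalent (range x) (range (\<lambda>k::int. inverse \<beta> * of_int k))"
  unfolding bounded_distance_equivalent_def
proof (intro exI conjI ballI)
  let ?h = "\<lambda>y. inverse \<beta> * of_int (the_inv x y)"
  have B0: "0 \<le> B" using B[of 0] by linarith
  show "0 < B / \<beta> + 1" using B0 beta by (simp add: add_nonneg_pos)
  show "bij_betw ?h (range x) (range (\<lambda>k::int. inverse \<beta> * of_int k))"
    unfolding bij_betw_def
  proof
    show "inj_on ?h (range x)" using beta inj by (auto simp: inj_on_def the_inv_f_f)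
    show "?h ` range x = range (\<lambda>k::int. inverse \<beta> * of_int k)"
      using inj by (auto simp: image_image the_inv_f_f)
  qed
  fix y assume "y \<in> range x"
  then obtain j where j: "y = x j" by blast
  have "\<bar>y - ?h y\<bar> = \<bar>real_of_int j - \<beta> * x j\<bar> / \<beta>"
  proof -
    have "y - ?h y = - (real_of_int j - \<beta> * x j) / \<beta>"
      using beta inj by (simp add: j the_inv_f_f field_simps)
    then show ?thesis using beta by (simp add: abs_minus_commute)
  qed
  also have "\<dots> \<le> B / \<beta>" using B beta by (simp add: divide_right_mono)
  finally show "\<bar>y - ?h y\<bar> < B / \<beta> + 1" by simp
qed

theorem theorem3p5:
  fixes m :: nat and \<sigma> :: "nat list \<Rightarrow> nat list" and l :: "real vec" and \<Lambda> :: "real set"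
  assumes "is_substitution m \<sigma>"
    and "primitive_subst m \<sigma>"
    and "pisot_subst m \<sigma>"
    and "diagonalizable_mat (subst_mat_complex m \<sigma>)"
    and "natural_tile_lengths m \<sigma> l"
    and "\<Lambda> \<in> geometric_hull m \<sigma> l"
  shows "bounded_distance_equivalent \<Lambda> (range (\<lambda>k::int. inverse (dens \<Lambda>) * of_int k))"
proof -
  obtain u x where u: "u \<in> symbolic_hull m \<sigma>" and x0: "x 0 = 0"
    and incr: "\<And>j :: int. x (j + 1) - x j = l $ u j" and \<Lambda>: "\<Lambda> = range x"
    using assms(6) unfolding geometric_hull_def by blast
  obtain \<beta> B where disc: "\<And>k i w. i < m \<Longrightarrow> sublist w ((\<sigma> ^^ k) [i]) \<Longrightarrow>
       \<bar>real (length w) - \<beta> * (\<Sum>x\<leftarrow>w. l $ x)\<bar> \<le> B"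
    using length_minus_scaled_weight_bounded[OF assms(1,3,4,5)] by blast
  (* every finite block of u is legal, hence has bounded discrepancy *)
  have block: "\<bar>real n - \<beta> * (x (a + int n) - x a)\<bar> \<le> B" for a n
  proof -
    let ?w = "map u [a..a + int n - 1]"
    obtain k i where "i < m" "sublist ?w ((\<sigma> ^^ k) [i])"
      using u unfolding symbolic_hull_def by blast
    from disc[OF this] show ?thesis
      unfolding sum_list_increments[of x "\<lambda>y. l $ y" u, OF incr] by simp
  qed
  have B: "\<bar>real_of_int j - \<beta> * x j\<bar> \<le> B" for j
  proof (cases "j \<ge> 0")
    case True
    then show ?thesis using block[of "nat j" 0] x0 by simp
  next
    case False
    (* the block runs from j up to 0, so both terms change sign *)
    then show ?thesis using block[of "nat (- j)" j] x0 by (simp add: abs_minus_commute algebra_simps)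
  qed
  have pos: "l $ u j > 0" for j
    using u assms(5) unfolding symbolic_hull_def natural_tile_lengths_def by blast
  have "strict_mono x"
  proof (rule strict_monoI)
    fix i j :: int assume "i < j"
    then show "x i < x j"
    proof (induction rule: int_gr_induct)
      case base
      then show ?case using incr[of i] pos[of i] by linarith
    next
      case (step j)
      then show ?case using incr[of j] pos[of j] by linarith
    qed
  qed
  then have inj: "inj x" and nonneg: "j > 0 \<Longrightarrow> x j > 0" for j
    using x0 strict_mono_imp_inj_on strict_monoD[of x 0 j] by auto
  (* otherwise j <= j - \<beta> * x j <= B for all positive j *)
  have beta: "\<beta> > 0"
  proof (rule ccontr)
    assume "\<not> \<beta> > 0"
    let ?j = "\<lfloor>\<bar>B\<bar>\<rfloor> + 1"
    have "x ?j > 0" by (rule nonneg) (simp add: add_nonneg_pos)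
    then have "\<beta> * x ?j \<le> 0" using \<open>\<not> \<beta> > 0\<close> by (simp add: mult_nonpos_nonneg)
    then show False using B[of ?j] by linarith
  qed
  show ?thesis
    unfolding \<Lambda> dens_of_bounded_discrepancy[OF inj beta B]
    by (rule bounded_distance_equivalent_lattice[OF inj beta B])
qed

end
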